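(* Let $(A,B,\alpha)$ be a crossed module and let $C$ be a subgroup of $\operatorname{Ker}\alpha$. Then there exists a lifting $(\varphi,X,\omega)$ of $(A,B,\alpha)$ such that $\operatorname{Ker}\varphi=C$. Moreover, for this lifting, $\operatorname{Ker}\omega\cong\operatorname{Ker}\alpha/C$.
   Context: Groups are written additively but need not be commutative. A crossed module $(A,B,\alpha)$ consists of groups $A,B$, a left action of $B$ on $A$ by group automorphisms, written $b\cdot a$, and a group morphism $\alpha\colon A\to B$ such that for all $a,a_1\in A$, $b\in B$: (CM1) $\alpha(b\cdot a)=b+\alpha(a)-b$; (CM2) $\alpha(a)\cdot a_1=a+a_1-a$. Given a crossed module $(A,B,\alpha)$ and a group morphism $\omega\colon X\to B$, the action of $X$ on $A$ via $\omega$ is $x\cdot a:=\omega(x)\cdot a$. A lifting $(\varphi,X,\omega)$ of $(A,B,\alpha)$ (also called a lifting of $\alpha$ over $\omega$) consists of a group $X$ and group morphisms $\omega\colon X\to B$, $\varphi\colon A\to X$ such that $\omega\varphi=\alpha$ and $(A,X,\varphi)$ is a crossed module with the action of $X$ on $A$ via $\omega$. The subgroup $\operatorname{Ker}\alpha$ is central in $A$, so $C$ is normal in $A$. *)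

theory Defs
  imports "HOL-Algebra.Group_Action"
begin

text \<open>
  Groups are written multiplicatively, as in the library. The action
  \<open>b \<cdot> a\<close> is \<open>act b a\<close>, where \<open>act\<close> is a homomorphism into the automorphism
  group \<open>AutoGroup A\<close>. Its elements are extensional functions composed from right
  to left, so these are exactly the left actions by group automorphisms, made
  \<^const>\<open>undefined\<close> outside \<open>carrier A\<close>.
\<close>

locale crossed_module =
  hom: group_hom A B \<alpha> + action: group_hom B "AutoGroup A" act
  for A :: "('a, 'm) monoid_scheme" (structure) and B :: "('b, 'n) monoid_scheme" (structure)
    and act :: "'b \<Rightarrow> 'a \<Rightarrow> 'a" and \<alpha> :: "'a \<Rightarrow> 'b" +
  assumes CM1: "\<lbrakk>a \<in> carrier A; b \<in> carrier B\<rbrakk>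
      \<Longrightarrow> \<alpha> (act b a) = b \<otimes>\<^bsub>B\<^esub> \<alpha> a \<otimes>\<^bsub>B\<^esub> inv\<^bsub>B\<^esub> b"
    and CM2: "\<lbrakk>a \<in> carrier A; a\<^sub>1 \<in> carrier A\<rbrakk>
      \<Longrightarrow> act (\<alpha> a) a\<^sub>1 = a \<otimes>\<^bsub>A\<^esub> a\<^sub>1 \<otimes>\<^bsub>A\<^esub> inv\<^bsub>A\<^esub> a"

locale crossed_module_lifting =
  base: crossed_module A B act \<alpha> +
  over: group_hom X B \<omega> +
  lift: crossed_module A X "\<lambda>x. act (\<omega> x)" \<phi>
  for A :: "('a, 'm) monoid_scheme" (structure) and B :: "('b, 'n) monoid_scheme" (structure)
    and act :: "'b \<Rightarrow> 'a \<Rightarrow> 'a" and \<alpha> :: "'a \<Rightarrow> 'b"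
    and \<phi> :: "'a \<Rightarrow> 'x" and X :: "('x, 'k) monoid_scheme" (structure) and \<omega> :: "'x \<Rightarrow> 'b" +
  assumes factorization: "a \<in> carrier A \<Longrightarrow> \<omega> (\<phi> a) = \<alpha> a"

text \<open>The kernel of a homomorphism as a group, rather than as a bare set.\<close>

abbreviation kernel_group ::
  "('a, 'm) monoid_scheme \<Rightarrow> ('b, 'n) monoid_scheme \<Rightarrow> ('a \<Rightarrow> 'b) \<Rightarrow> ('a, 'm) monoid_scheme"
  where "kernel_group G H h \<equiv> G\<lparr>carrier := kernel G H h\<rparr>"

end

theory Submission
  imports Defs
begin

text \<open>
  Peiffer's identity CM2 makes \<open>Ker \<alpha>\<close> central, so \<open>C\<close> is normal and \<open>X = A / C\<close> is a group.
  Since \<open>\<alpha>\<close> is constant on the cosets of \<open>C\<close>, it descends to \<open>\<omega> : A / C \<rightarrow> B\<close>, and the axioms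
  for the projection \<open>\<phi> : A \<rightarrow> A / C\<close> follow from CM2. The kernel of \<open>\<omega>\<close> consists of the cosets
  lying in \<open>Ker \<alpha>\<close>, so it is \<open>Ker \<alpha> / C\<close> on the nose.
\<close>

lemma AutoGroup_one_apply:
  "a \<in> carrier G \<Longrightarrow> \<one>\<^bsub>AutoGroup G\<^esub> a = a"
  by (simp add: AutoGroup_def BijGroup_def)

context crossed_module
begin

lemma kernel_central:
  assumes k: "k \<in> kernel A B \<alpha>" and a: "a \<in> carrier A"
  shows "k \<otimes> a = a \<otimes> k"
proof -
  have kA: "k \<in> carrier A" and "\<alpha> k = \<one>\<^bsub>B\<^esub>"
    using k by (auto simp: kernel_def)
  \<comment> \<open>The homomorphism \<open>act\<close> sends the trivial \<open>\<alpha> k\<close>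
    to the identity on \<open>A\<close>, so CM2 says that conjugation by \<open>k\<close> fixes
    \<open>a\<close>.\<close>
  then have "k \<otimes> a \<otimes> inv k = a"
    using CM2[OF kA a] a by (simp add: action.hom_one AutoGroup_one_apply)
  then show ?thesis
    using kA a by (metis hom.G.inv_solve_right hom.G.m_closed)
qed

lemma normal_if_subgroup_kernel:
  assumes "subgroup C (kernel_group A B \<alpha>)"
  shows "C \<lhd> A"
proof -
  have C: "subgroup C A"
    using hom.G.incl_subgroup[OF hom.subgroup_kernel assms] .
  have "C \<subseteq> kernel A B \<alpha>"
    using subgroup.subset[OF assms] by simp
  \<comment> \<open>Centrality makes conjugation fix \<open>C\<close> pointwise, which is more than
    the invariance that \<open>normal_inv_iff\<close> asks for.\<close>
  then have "x \<otimes> h \<otimes> inv x = h" if "x \<in> carrier A" "h \<in> C" for x h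
    using that kernel_central[of h x, symmetric] subgroup.mem_carrier[OF C]
    by (auto simp: hom.G.inv_solve_right')
  then show ?thesis
    using C hom.G.normal_inv_iff by simp
qed

end

text \<open>Elements of the coset differ from \<open>a\<close> by a left factor on which
  \<open>h\<close> is trivial, so \<open>h\<close> takes a single value there. Reading it off with
  \<open>the_elem\<close> makes \<open>h\<close> descend to the quotient without a choice of
  representatives.\<close>

lemma (in group_hom) the_elem_image_rcoset:
  assumes "subgroup C G" "C \<subseteq> kernel G H h" "a \<in> carrier G"
  shows "the_elem (h ` (C #>\<^bsub>G\<^esub> a)) = h a"
proof -
  have "h x = h a" if "x \<in> C #>\<^bsub>G\<^esub> a" for x
    using that assms by (auto simp: r_coset_def kernel_def)
  moreover have "a \<in> C #>\<^bsub>G\<^esub> a"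
    using assms G.rcos_self by blast
  ultimately have "h ` (C #>\<^bsub>G\<^esub> a) = {h a}"
    by blast
  then show ?thesis
    by simp
qed

lemma (in group_hom) the_elem_image_hom_Mod:
  assumes "C \<lhd> G" "C \<subseteq> kernel G H h"
  shows "(\<lambda>S. the_elem (h ` S)) \<in> hom (G Mod C) H"
proof -
  interpret C: normal C G by fact
  note elem = the_elem_image_rcoset[OF C.subgroup_axioms assms(2)]
  show ?thesis
    by (rule homI) (auto simp: FactGroup_def RCOSETS_def C.rcos_sum elem)
qed

text \<open>The descended map has value \<open>h a\<close> on the coset of \<open>a\<close>, so a
  coset is in its kernel exactly when \<open>a\<close> is in that of \<open>h\<close>. Restricting
  the carrier changes neither the coset of such an \<open>a\<close> nor the product of sets, hence
  an equality and not just an isomorphism.\<close>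

lemma (in group_hom) kernel_group_the_elem_image_Mod:
  assumes "subgroup C G" "C \<subseteq> kernel G H h"
  shows "kernel_group (G Mod C) H (\<lambda>S. the_elem (h ` S)) = kernel_group G H h Mod C"
proof -
  have "kernel (G Mod C) H (\<lambda>S. the_elem (h ` S)) = rcosets\<^bsub>kernel_group G H h\<^esub> C"
    using the_elem_image_rcoset[OF assms]
    by (auto simp: kernel_def FactGroup_def RCOSETS_def r_coset_def)
  then show ?thesis
    by (simp add: FactGroup_def set_mult_def fun_eq_iff)
qed

lemma (in normal) kernel_r_coset_Mod: "kernel G (G Mod H) (\<lambda>a. H #> a) = H"
  using rcos_const subgroup_axioms
  by (auto simp: kernel_def FactGroup_def rcos_self coset_join1 intro: mem_carrier)

lemma (in crossed_module) crossed_module_lifting_Mod: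
  assumes "subgroup C (kernel_group A B \<alpha>)"
  shows "crossed_module_lifting A B act \<alpha> (\<lambda>a. C #> a) (A Mod C) (\<lambda>S. the_elem (\<alpha> ` S))"
    (is "crossed_module_lifting A B act \<alpha> ?\<phi> ?X ?\<omega>")
proof -
  interpret C: normal C A
    using normal_if_subgroup_kernel[OF assms] .
  have sub: "C \<subseteq> kernel A B \<alpha>"
    using subgroup.subset[OF assms] by simp
  note \<omega>_coset = hom.the_elem_image_rcoset[OF C.subgroup_axioms sub]
  interpret X: group ?X
    by (rule C.factorgroup_is_group)
  interpret \<omega>: group_hom ?X B ?\<omega>
    by unfold_locales (rule hom.the_elem_image_hom_Mod[OF C.normal_axioms sub])
  interpret \<phi>: group_hom A ?X ?\<phi>
    by unfold_locales (rule C.r_coset_hom_Mod)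
  interpret via: group_hom ?X "AutoGroup A" "\<lambda>x. act (?\<omega> x)"
    using hom_compose[OF \<omega>.homh action.homh] by unfold_locales (simp add: comp_def)
  show ?thesis
  proof unfold_locales
    fix a x
    assume a: "a \<in> carrier A" and "x \<in> carrier ?X"
    then obtain y where y: "y \<in> carrier A" "x = C #> y"
      by (auto simp: FactGroup_def RCOSETS_def)
    \<comment> \<open>Since \<open>?\<omega> x = \<alpha> y\<close>, CM2 turns the action into
      conjugation by \<open>y\<close>, which the projection carries to conjugation by
      \<open>x\<close>.\<close>
    then show "C #> act (?\<omega> x) a = x \<otimes>\<^bsub>?X\<^esub> (C #> a) \<otimes>\<^bsub>?X\<^esub> inv\<^bsub>?X\<^esub> x"
      using a by (simp add: \<omega>_coset CM2)
  \<comment> \<open>CM2 for \<open>?\<phi>\<close> and the factorization remain; both reduce to the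
    value \<open>\<alpha> a\<close> of \<open>?\<omega>\<close> on the coset of
    \<open>a\<close>.\<close>
  qed (simp_all add: \<omega>_coset CM2)
qed

theorem theorem4p5:
  fixes A :: "('a, 'm) monoid_scheme" and B :: "('b, 'n) monoid_scheme"
    and act :: "'b \<Rightarrow> 'a \<Rightarrow> 'a" and \<alpha> :: "'a \<Rightarrow> 'b" and C :: "'a set"
  assumes "crossed_module A B act \<alpha>"
    and "subgroup C (kernel_group A B \<alpha>)"
  shows "\<exists>(\<phi> :: 'a \<Rightarrow> 'a set) (X :: 'a set monoid) (\<omega> :: 'a set \<Rightarrow> 'b).
    crossed_module_lifting A B act \<alpha> \<phi> X \<omega> \<and>
    kernel A X \<phi> = C \<and>
    kernel_group X B \<omega> \<cong> kernel_group A B \<alpha> Mod C"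
proof -
  interpret crossed_module A B act \<alpha> by fact
  interpret C: normal C A
    using normal_if_subgroup_kernel[OF assms(2)] .
  have "C \<subseteq> kernel A B \<alpha>"
    using subgroup.subset[OF assms(2)] by simp
  then have "kernel_group (A Mod C) B (\<lambda>S. the_elem (\<alpha> ` S)) \<cong> kernel_group A B \<alpha> Mod C"
    using hom.kernel_group_the_elem_image_Mod[OF C.subgroup_axioms] iso_refl by simp
  then show ?thesis
    using crossed_module_lifting_Mod[OF assms(2)] C.kernel_r_coset_Mod by blast
qed

end
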